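(* In $Sol_3$ there are graphical translators defined on a half-plane: there exist a Killing vector field $V$ of $Sol_3$, a real number $z_1$, and a complete $F_1$-invariant translator $\mathcal M$ in the direction of $V$ which is the graph $\{(x,F(z),z): x\in\mathbb R,\ z>z_1\}$ of a function $y=F(z)$ defined on the half-plane $\{(x,z):z>z_1\}$.
   Context: $Sol_3$ is $\mathbb R^3$ with coordinates $(x,y,z)$, group law $(x_1,y_1,z_1)\star(x_2,y_2,z_2)=(x_1+e^{-z_1}x_2,\;y_1+e^{z_1}y_2,\;z_1+z_2)$ and left-invariant metric $\bar g=e^{2z}dx^2+e^{-2z}dy^2+dz^2$. Its Killing vector fields are the constant-coefficient linear combinations of $F_1=\partial_x$, $F_2=\partial_y$, $F_3=-x\partial_x+y\partial_y+\partial_z$. A surface $\mathcal M$ with unit normal $\nu$ is a translator in the direction of a Killing field $V$ if $H=\bar g(\nu,V)$, where $H$ is the mean curvature, i.e. the trace of the second fundamental form $A(S,T)=\bar g(\bar\nabla_S T,\nu)$ (sum of the principal curvatures). A surface is $F_1$-invariant if it is invariant under all the isometries $(x,y,z)\mapsto(x+t,y,z)$, $t\in\mathbb R$. *)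

theory Defs
  imports "HOL-Analysis.Analysis"
begin

section \<open>The Riemannian manifold \<open>Sol\<^sub>3\<close>\<close>

text \<open>
  The underlying manifold is \<open>\<real>\<^sup>3\<close> with its global coordinates \<open>(x, y, z) = (p$1, p$2, p$3)\<close>.
  All tangent spaces are identified with \<open>real^3\<close> by means of the coordinate frame.
\<close>

definition sol_metric :: "real^3 \<Rightarrow> real^3 \<Rightarrow> real^3 \<Rightarrow> real" where
  "sol_metric p u v = exp (2 * p$3) * u$1 * v$1 + exp (- 2 * p$3) * u$2 * v$2 + u$3 * v$3"

definition sol_gram :: "real^3 \<Rightarrow> real^3^3" where
  "sol_gram p = (\<chi> i j. sol_metric p (axis i 1) (axis j 1))"

definition sol_gram_deriv :: "3 \<Rightarrow> 3 \<Rightarrow> 3 \<Rightarrow> real^3 \<Rightarrow> real" where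
  "sol_gram_deriv l i j p = frechet_derivative (\<lambda>q. sol_gram q $ i $ j) (at p) (axis l 1)"

definition sol_christoffel :: "3 \<Rightarrow> 3 \<Rightarrow> 3 \<Rightarrow> real^3 \<Rightarrow> real" where
  "sol_christoffel k i j p =
     (1/2) * (\<Sum>l\<in>UNIV. matrix_inv (sol_gram p) $ k $ l *
       (sol_gram_deriv i j l p + sol_gram_deriv j i l p - sol_gram_deriv l i j p))"

text \<open>Levi-Civita covariant derivative of the vector field \<open>T\<close> at \<open>p\<close> in the direction \<open>s\<close>.\<close>

definition sol_nabla :: "real^3 \<Rightarrow> real^3 \<Rightarrow> (real^3 \<Rightarrow> real^3) \<Rightarrow> real^3" where
  "sol_nabla p s T = frechet_derivative T (at p) s +
     (\<chi> k. \<Sum>i\<in>UNIV. \<Sum>j\<in>UNIV. sol_christoffel k i j p * s$i * T p $ j)"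

definition sol_F1 :: "real^3 \<Rightarrow> real^3" where "sol_F1 p = vector [1, 0, 0]"
definition sol_F2 :: "real^3 \<Rightarrow> real^3" where "sol_F2 p = vector [0, 1, 0]"
definition sol_F3 :: "real^3 \<Rightarrow> real^3" where "sol_F3 p = vector [- (p$1), p$2, 1]"

text \<open>
  The Killing fields of \<open>Sol\<^sub>3\<close> are the constant-coefficient combinations of
  \<open>F\<^sub>1, F\<^sub>2, F\<^sub>3\<close>; the lemma \<open>killing_equation\<close> below checks that these satisfy the
  Killing equation.
\<close>

definition sol_killing :: "(real^3 \<Rightarrow> real^3) \<Rightarrow> bool" where
  "sol_killing V \<longleftrightarrow>
     (\<exists>a b c. V = (\<lambda>p. a *\<^sub>R sol_F1 p + b *\<^sub>R sol_F2 p + c *\<^sub>R sol_F3 p))"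


section \<open>Smooth embedded surfaces\<close>

text \<open>
  On an open subset of a Euclidean space, \<open>Ck_on k S f\<close> says that \<open>f\<close> is of class \<open>C\<^sup>k\<close>:
  all iterated directional derivatives up to order \<open>k\<close> exist and are continuous.
\<close>

primrec Ck_on :: "nat \<Rightarrow> 'a::real_normed_vector set \<Rightarrow> ('a \<Rightarrow> 'b::real_normed_vector) \<Rightarrow> bool" where
  "Ck_on 0 S f = continuous_on S f"
| "Ck_on (Suc k) S f = ((\<forall>x\<in>S. f differentiable (at x)) \<and>
     (\<forall>v. Ck_on k S (\<lambda>x. frechet_derivative f (at x) v)))"

definition smooth_on :: "'a::real_normed_vector set \<Rightarrow> ('a \<Rightarrow> 'b::real_normed_vector) \<Rightarrow> bool" where
  "smooth_on S f \<longleftrightarrow> (\<forall>k. Ck_on k S f)"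

definition smooth_surface :: "(real^3) set \<Rightarrow> bool" where
  "smooth_surface M \<longleftrightarrow>
     (\<forall>p\<in>M. \<exists>(U::(real^2) set) W X Y.
        open U \<and> open W \<and> p \<in> W \<and> smooth_on U X \<and> homeomorphism U (M \<inter> W) X Y \<and>
        (\<forall>u\<in>U. inj (frechet_derivative X (at u))))"

definition tangent_space :: "(real^3) set \<Rightarrow> real^3 \<Rightarrow> (real^3) set" where
  "tangent_space M p =
     {v. \<exists>e>0. \<exists>c. smooth_on {-e<..<e} c \<and> c ` {-e<..<e} \<subseteq> M \<and> c 0 = p \<and>
           (c has_vector_derivative v) (at 0)}"

definition sol_unit_normal :: "(real^3) set \<Rightarrow> (real^3 \<Rightarrow> real^3) \<Rightarrow> bool" where
  "sol_unit_normal M \<nu> \<longleftrightarrow> continuous_on M \<nu> \<and>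
     (\<forall>p\<in>M. sol_metric p (\<nu> p) (\<nu> p) = 1 \<and> (\<forall>v\<in>tangent_space M p. sol_metric p (\<nu> p) v = 0))"

text \<open>A smooth vector field near \<open>p\<close> that is tangent to \<open>M\<close> along \<open>M\<close> and has the value \<open>t\<close> at \<open>p\<close>.\<close>

definition tangent_extension :: "(real^3) set \<Rightarrow> real^3 \<Rightarrow> real^3 \<Rightarrow> (real^3 \<Rightarrow> real^3) \<Rightarrow> bool" where
  "tangent_extension M p t T \<longleftrightarrow>
     (\<exists>W. open W \<and> p \<in> W \<and> smooth_on W T \<and> (\<forall>q\<in>M \<inter> W. T q \<in> tangent_space M q)) \<and> T p = t"

text \<open>
  \<open>A(s, t) = g(\<nabla>\<^sub>s T, \<nu>)\<close> for \<open>s, t\<close> tangent to \<open>M\<close> at \<open>p\<close>, where \<open>T\<close> is any tangential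
  extension of \<open>t\<close>; the value does not depend on the extension.
\<close>

definition sol_second_ff ::
  "(real^3) set \<Rightarrow> (real^3 \<Rightarrow> real^3) \<Rightarrow> real^3 \<Rightarrow> real^3 \<Rightarrow> real^3 \<Rightarrow> real" where
  "sol_second_ff M \<nu> p s t =
     sol_metric p (sol_nabla p s (SOME T. tangent_extension M p t T)) (\<nu> p)"

definition sol_orthonormal_basis :: "(real^3) set \<Rightarrow> real^3 \<Rightarrow> (real^3) \<times> (real^3) \<Rightarrow> bool" where
  "sol_orthonormal_basis M p = (\<lambda>(e1, e2). e1 \<in> tangent_space M p \<and> e2 \<in> tangent_space M p \<and>
     sol_metric p e1 e1 = 1 \<and> sol_metric p e2 e2 = 1 \<and> sol_metric p e1 e2 = 0)"

text \<open>The trace is independent of the orthonormal basis of the tangent plane.\<close>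

definition sol_mean_curvature :: "(real^3) set \<Rightarrow> (real^3 \<Rightarrow> real^3) \<Rightarrow> real^3 \<Rightarrow> real" where
  "sol_mean_curvature M \<nu> p =
     (case (SOME b. sol_orthonormal_basis M p b) of
        (e1, e2) \<Rightarrow> sol_second_ff M \<nu> p e1 e1 + sol_second_ff M \<nu> p e2 e2)"

definition sol_translator :: "(real^3 \<Rightarrow> real^3) \<Rightarrow> (real^3) set \<Rightarrow> bool" where
  "sol_translator V M \<longleftrightarrow> smooth_surface M \<and>
     (\<exists>\<nu>. sol_unit_normal M \<nu> \<and>
        (\<forall>p\<in>M. sol_mean_curvature M \<nu> p = sol_metric p (\<nu> p) (V p)))"

definition F1_invariant :: "(real^3) set \<Rightarrow> bool" where
  "F1_invariant M \<longleftrightarrow> (\<forall>t::real. (\<lambda>p. vector [p$1 + t, p$2, p$3]) ` M = M)"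


section \<open>Completeness\<close>

definition sol_length :: "(real \<Rightarrow> real^3) \<Rightarrow> ennreal" where
  "sol_length c = (\<integral>\<^sup>+t\<in>{0..1}. ennreal (sqrt (sol_metric (c t)
     (vector_derivative c (at t)) (vector_derivative c (at t)))) \<partial>lborel)"

text \<open>
  The intrinsic distance of the metric induced on \<open>M\<close> (\<open>\<infinity>\<close> between points that no path
  in \<open>M\<close> joins).
\<close>

definition sol_intrinsic_dist :: "(real^3) set \<Rightarrow> real^3 \<Rightarrow> real^3 \<Rightarrow> ennreal" where
  "sol_intrinsic_dist M p q =
     (INF c\<in>{c. c piecewise_C1_differentiable_on {0..1} \<and> path_image c \<subseteq> M \<and>
               pathstart c = p \<and> pathfinish c = q}. sol_length c)"

definition sol_complete :: "(real^3) set \<Rightarrow> bool" where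
  "sol_complete M \<longleftrightarrow>
     (\<forall>\<sigma>::nat \<Rightarrow> real^3. range \<sigma> \<subseteq> M \<and>
        (\<forall>e>0. \<exists>N. \<forall>m\<ge>N. \<forall>n\<ge>N. sol_intrinsic_dist M (\<sigma> m) (\<sigma> n) < e) \<longrightarrow>
        (\<exists>l\<in>M. (\<lambda>n. sol_intrinsic_dist M (\<sigma> n) l) \<longlonglongrightarrow> 0))"


section \<open>The connection in coordinates, and the Killing equation\<close>

lemma sol_gram_eq: "sol_gram p = (\<chi> i j. if i = j then (if i = 1 then exp (2 * p$3)
    else if i = 2 then exp (- 2 * p$3) else 1) else 0)"
  by (simp add: sol_gram_def sol_metric_def vec_eq_iff forall_3 axis_def)

lemma sol_gram_inv: "matrix_inv (sol_gram p) = (\<chi> i j. if i = j then (if i = 1 then exp (- 2 * p$3)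
    else if i = 2 then exp (2 * p$3) else 1) else 0)" (is "_ = ?B")
proof -
  have 1: "sol_gram p ** ?B = mat 1" and 2: "?B ** sol_gram p = mat 1"
    by (simp_all add: sol_gram_eq matrix_matrix_mult_def mat_def vec_eq_iff forall_3 sum_3
        flip: exp_add)
  have inv: "matrix_inv (sol_gram p) ** sol_gram p = mat 1"
    using someI[of "\<lambda>B. sol_gram p ** B = mat 1 \<and> B ** sol_gram p = mat 1" ?B] 1 2
    unfolding matrix_inv_def by simp
  have "matrix_inv (sol_gram p) = matrix_inv (sol_gram p) ** (sol_gram p ** ?B)"
    by (simp only: 1 matrix_mul_rid)
  also have "\<dots> = ?B"
    by (simp only: matrix_mul_assoc inv matrix_mul_lid)
  finally show ?thesis .
qed

lemma sol_gram_deriv_eq: "sol_gram_deriv l i j p =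
    (if i = j \<and> l = 3 then (if i = 1 then 2 * exp (2 * p$3)
      else if i = 2 then - 2 * exp (- 2 * p$3) else 0) else 0)"
proof -
  have c3: "((\<lambda>q::real^3. q$3) has_derivative (\<lambda>h. h$3)) (at p)"
    by (rule bounded_linear_imp_has_derivative) (rule bounded_linear_vec_nth)
  have e: "((\<lambda>q::real^3. exp (c * q$3)) has_derivative (\<lambda>h. c * exp (c * p$3) * h$3)) (at p)" for c
    by (auto intro!: derivative_eq_intros c3)
  have d: "frechet_derivative (\<lambda>q::real^3. exp (c * q$3)) (at p) = (\<lambda>h. c * exp (c * p$3) * h$3)" for c
    by (rule frechet_derivative_at[OF e, symmetric])
  consider "i \<noteq> j" | "i = j" "i = 1" | "i = j" "i = 2" | "i = j" "i = 3"
    using exhaust_3[of i] by blast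
  then show ?thesis
  proof cases
    case 1
    then show ?thesis by (simp add: sol_gram_deriv_def sol_gram_eq)
  next
    case 2
    then show ?thesis using d[of 2] by (simp add: sol_gram_deriv_def sol_gram_eq axis_def)
  next
    case 3
    then show ?thesis using d[of "-2"] by (simp add: sol_gram_deriv_def sol_gram_eq axis_def)
  next
    case 4
    then show ?thesis by (simp add: sol_gram_deriv_def sol_gram_eq)
  qed
qed

lemma sol_nabla_eq: "sol_nabla p s T = frechet_derivative T (at p) s +
    vector [s$1 * T p$3 + s$3 * T p$1,
            - (s$2 * T p$3) - s$3 * T p$2,
            exp (- 2 * p$3) * s$2 * T p$2 - exp (2 * p$3) * s$1 * T p$1]"
  by (simp add: sol_nabla_def sol_christoffel_def sol_gram_inv sol_gram_deriv_eq vec_eq_iff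
      forall_3 sum_3 algebra_simps flip: exp_add)

lemma killing_equation:
  assumes "sol_killing V"
  shows "sol_metric p (sol_nabla p u V) v + sol_metric p u (sol_nabla p v V) = 0"
proof -
  obtain a b c where V: "V = (\<lambda>p. a *\<^sub>R sol_F1 p + b *\<^sub>R sol_F2 p + c *\<^sub>R sol_F3 p)"
    using assms by (auto simp: sol_killing_def)
  have V': "V = (\<lambda>p. vector [a - c * p$1, b + c * p$2, c])"
    by (auto simp: V sol_F1_def sol_F2_def sol_F3_def vec_eq_iff forall_3)
  have nth: "((\<lambda>q::real^3. q$i) has_derivative (\<lambda>h. h$i)) (at p)" for i
    by (rule bounded_linear_imp_has_derivative) (rule bounded_linear_vec_nth)
  have "(V has_derivative (\<lambda>h. vector [- c * h$1, c * h$2, 0])) (at p)"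
    unfolding V'
  proof (rule has_derivative_componentwise_within[THEN iffD2], intro ballI)
    fix i :: "real^3" assume "i \<in> Basis"
    then obtain k where "i = axis k 1" by (auto simp: Basis_vec_def)
    moreover have "((\<lambda>q::real^3. (vector [a - c * q$1, b + c * q$2, c] :: real^3) $ k)
      has_derivative (\<lambda>h. (vector [- c * h$1, c * h$2, 0] :: real^3) $ k)) (at p)"
      using exhaust_3[of k] by (auto intro!: derivative_eq_intros nth)
    ultimately show "((\<lambda>q::real^3. vector [a - c * q$1, b + c * q$2, c] \<bullet> i)
      has_derivative (\<lambda>h. vector [- c * h$1, c * h$2, 0] \<bullet> i)) (at p)"
      by (simp add: inner_axis)
  qed
  from frechet_derivative_at[OF this, symmetric] show ?thesis
    by (simp add: sol_nabla_eq sol_metric_def V' algebra_simps flip: exp_add)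
qed

end

theory Submission
  imports Defs "HOL-Complex_Analysis.Cauchy_Integral_Formula"
begin

text \<open>
  Let \<open>w = exp (- z) * F' z\<close> be the slope of the profile curve in the orthonormal frame
  \<open>e\<^sup>z \<partial>\<^sub>y, \<partial>\<^sub>z\<close>. The two terms of the mean curvature of the graph combine to
  \<open>H = w' / (1 + w\<^sup>2)\<^bsup>3/2\<^esup>\<close>, and the normal component of \<open>F\<^sub>2\<close> is \<open>e\<^bsup>-z\<^esup> / (1 + w\<^sup>2)\<^bsup>1/2\<^esup>\<close>.
  Hence the graph is a translator in the direction of \<open>F\<^sub>2\<close> iff \<open>w' / (1 + w\<^sup>2) = e\<^bsup>-z\<^esup>\<close>, with the
  solution \<open>w = - tan (e\<^bsup>-z\<^esup>)\<close>. It is defined for \<open>e\<^bsup>-z\<^esup> < \<pi>/2\<close>, and the length element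
  \<open>(1 + w\<^sup>2)\<^bsup>1/2\<^esup> dz\<close> dominates, up to the factor \<open>\<pi>/2\<close>, the differential of \<open>ln (cos (e\<^bsup>-z\<^esup>))\<close>,
  which tends to \<open>- \<infinity>\<close> at the boundary; so no curve of finite length reaches the boundary.
\<close>

section \<open>Smooth functions\<close>

text \<open>Since \<open>S\<close> is open, agreement on \<open>S\<close> is agreement near each of
  its points, so the derivatives agree on \<open>S\<close> as well and the induction
  descends.\<close>

lemma Ck_on_cong:
  assumes "open S" "\<And>x. x \<in> S \<Longrightarrow> f x = g x" "Ck_on k S f"
  shows "Ck_on k S g"
  using assms(2,3)
proof (induction k arbitrary: f g)
  case 0
  then show ?case using continuous_on_cong[of S S f g] by simp
next
  case (Suc k)
  have der: "(g has_derivative frechet_derivative f (at x)) (at x)" if "x \<in> S" for x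
  proof (rule has_derivative_transform_within_open)
    show "(f has_derivative frechet_derivative f (at x)) (at x)"
      using Suc.prems(2) that by (simp add: frechet_derivative_works)
  qed (use Suc.prems(1) assms(1) that in auto)
  have "Ck_on k S (\<lambda>x. frechet_derivative g (at x) v)" for v
  proof (rule Suc.IH)
    show "Ck_on k S (\<lambda>x. frechet_derivative f (at x) v)" using Suc.prems(2) by simp
    show "frechet_derivative f (at x) v = frechet_derivative g (at x) v" if "x \<in> S" for x
      using frechet_derivative_at[OF der[OF that]] by simp
  qed
  then show ?case using der unfolding Ck_on.simps differentiable_def by blast
qed

text \<open>Maps of this shape are closed under directional derivatives: in direction
  \<open>v\<close> the constant becomes \<open>N v\<close>, the linear part 0, the profile
  \<open>h'\<close> and the vector \<open>L v *\<^sub>R b\<close>. Hence the induction over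
  arbitrary \<open>a\<close>, \<open>N\<close>, \<open>b\<close> and \<open>h\<close>. Charts,
  lifted lines and tangent fields of a graph all have this shape.\<close>

lemma Ck_on_compose_affine:
  fixes L :: "'a::real_normed_vector \<Rightarrow> real" and N :: "'a \<Rightarrow> 'b::real_normed_vector"
  assumes "open S" "bounded_linear L" "\<And>x. x \<in> S \<Longrightarrow> r + L x \<in> I"
    and "bounded_linear N" "Ck_on k I h"
  shows "Ck_on k S (\<lambda>x. a + N x + h (r + L x) *\<^sub>R b)"
  using assms(4,5)
proof (induction k arbitrary: a N b h)
  case 0
  have "continuous_on S (\<lambda>x. h (r + L x))"
    by (rule continuous_on_compose2[of I h]) (use 0 assms(3) in \<open>auto intro!: continuous_on_add[OF continuous_on_const
          linear_continuous_on[OF assms(2)]]\<close>)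
  with 0 show ?case
    by (auto intro!: continuous_intros linear_continuous_on[OF 0(1)])
next
  case (Suc k)
  define h' where "h' y = frechet_derivative h (at y) 1" for y
  have h: "(h has_real_derivative h' y) (at y)" if "y \<in> I" for y
  proof -
    have d: "(h has_derivative frechet_derivative h (at y)) (at y)"
      using Suc.prems(2) that by (simp add: frechet_derivative_works)
    have "frechet_derivative h (at y) v = h' y * v" for v
      using linear_cmul[OF has_derivative_linear[OF d], of v 1] by (simp add: h'_def)
    then have "frechet_derivative h (at y) = (*) (h' y)" by (rule ext)
    with d show ?thesis by (simp add: has_field_derivative_def)
  qed
  have der: "((\<lambda>x. a + N x + h (r + L x) *\<^sub>R b) has_derivative
      (\<lambda>v. N v + 0 + h' (r + L x) *\<^sub>R (L v *\<^sub>R b))) (at x)" if "x \<in> S" for x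
  proof -
    have L: "((\<lambda>x. r + L x) has_derivative L) (at x)"
      by (auto intro!: derivative_eq_intros bounded_linear_imp_has_derivative assms(2))
    have "((\<lambda>x. h (r + L x)) has_derivative (\<lambda>v. h' (r + L x) * L v)) (at x)"
      using has_derivative_compose[OF L h[OF assms(3)[OF that], unfolded has_field_derivative_def]]
      by simp
    then show ?thesis
      by (auto intro!: derivative_eq_intros bounded_linear_imp_has_derivative Suc.prems(1))
  qed
  have "Ck_on k S (\<lambda>x. frechet_derivative (\<lambda>x. a + N x + h (r + L x) *\<^sub>R b) (at x) v)" for v
  proof (rule Ck_on_cong)
    show "Ck_on k S (\<lambda>x. N v + 0 + h' (r + L x) *\<^sub>R (L v *\<^sub>R b))"
      by (rule Suc.IH) (use Suc.prems(2) in \<open>auto simp: h'_def\<close>)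
    show "N v + 0 + h' (r + L x) *\<^sub>R (L v *\<^sub>R b)
      = frechet_derivative (\<lambda>x. a + N x + h (r + L x) *\<^sub>R b) (at x) v" if "x \<in> S" for x
      using frechet_derivative_at[OF der[OF that]] by metis
  qed (rule assms(1))
  then show ?case using der by (auto simp: differentiable_def)
qed

lemma smooth_on_compose_affine:
  fixes L :: "'a::real_normed_vector \<Rightarrow> real" and N :: "'a \<Rightarrow> 'b::real_normed_vector"
  assumes "smooth_on I h" "open S" "bounded_linear L" "bounded_linear N"
    and "\<And>x. x \<in> S \<Longrightarrow> r + L x \<in> I"
    and "\<And>x. f x = a + N x + h (r + L x) *\<^sub>R b"
  shows "smooth_on S f"
proof -
  have "f = (\<lambda>x. a + N x + h (r + L x) *\<^sub>R b)" using assms(6) by blast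
  then show ?thesis
    using Ck_on_compose_affine[OF assms(2,3,5,4)] assms(1) by (simp add: smooth_on_def)
qed

lemma smooth_on_deriv:
  fixes h :: "real \<Rightarrow> real"
  assumes "smooth_on I h" "open I"
  shows "y \<in> I \<Longrightarrow> (h has_real_derivative deriv h y) (at y)" and "smooth_on I (deriv h)"
proof -
  have D: "Ck_on k I h" for k using assms(1) by (simp add: smooth_on_def)
  have d: "(h has_real_derivative deriv h y) (at y)" if "y \<in> I" for y
    using D[of "Suc 0"] that by (simp add: DERIV_deriv_iff_real_differentiable)
  then show "y \<in> I \<Longrightarrow> (h has_real_derivative deriv h y) (at y)" .
  have "Ck_on k I (deriv h)" for k
  proof (rule Ck_on_cong[OF assms(2)])
    show "Ck_on k I (\<lambda>x. frechet_derivative h (at x) 1)" using D[of "Suc k"] by simp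
    show "frechet_derivative h (at x) 1 = deriv h x" if "x \<in> I" for x
      using frechet_derivative_at[OF d[OF that, unfolded has_field_derivative_def]] by (metis mult.right_neutral)
  qed
  then show "smooth_on I (deriv h)" by (simp add: smooth_on_def)
qed

text \<open>A derivative of \<open>F\<close> of positive order is a derivative of \<open>f\<close>,
  one order lower, times a constant. The profile of the translator is known only through its
  derivative, so its smoothness comes from here.\<close>

lemma smooth_on_antiderivative:
  fixes f :: "real \<Rightarrow> real"
  assumes "smooth_on I f" "open I" "\<And>x. x \<in> I \<Longrightarrow> (F has_real_derivative f x) (at x)"
  shows "smooth_on I F"
  unfolding smooth_on_def
proof
  fix k
  show "Ck_on k I F"
  proof (cases k)
    case 0
    then show ?thesis using assms(3) by (auto intro!: continuous_at_imp_continuous_on DERIV_isCont)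
  next
    case (Suc n)
    have "Ck_on n I (\<lambda>x. frechet_derivative F (at x) v)" for v
    proof (rule Ck_on_cong[OF assms(2)])
      have "smooth_on I (\<lambda>x. f x * v)"
        by (rule smooth_on_compose_affine[where h = f and r = 0 and a = 0 and N = "\<lambda>_. 0"
              and L = "\<lambda>x. x" and b = v]) (use assms in auto)
      then show "Ck_on n I (\<lambda>x. f x * v)" by (simp add: smooth_on_def)
      show "f x * v = frechet_derivative F (at x) v" if "x \<in> I" for x
        using frechet_derivative_at[OF assms(3)[OF that, unfolded has_field_derivative_def]] by metis
    qed
    then show ?thesis using Suc assms(3)
      by (auto simp: has_field_derivative_def differentiable_def)
  qed
qed

text \<open>Real parts of holomorphic functions are stable under real differentiation because
  \<open>deriv g\<close> is again holomorphic, so one derivative computation serves every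
  order.\<close>

lemma smooth_on_Re_holomorphic:
  assumes "g holomorphic_on \<Omega>" "open \<Omega>" "open I" "complex_of_real ` I \<subseteq> \<Omega>"
  shows "smooth_on I (\<lambda>x. Re (g (of_real x)))"
proof -
  have der: "((\<lambda>x. Re (g (of_real x))) has_real_derivative Re (deriv g (of_real x))) (at x)"
    if "g holomorphic_on \<Omega>" "x \<in> I" for g x
  proof -
    have "(g has_field_derivative deriv g (of_real x)) (at (of_real x))"
      using that assms(2,4) by (auto intro: holomorphic_derivI)
    then have "((\<lambda>x. g (of_real x)) has_vector_derivative deriv g (of_real x)) (at x)"
      by (intro has_vector_derivative_real_field)
    then show ?thesis
      using bounded_linear.has_vector_derivative[OF bounded_linear_Re]
      by (fastforce simp: has_real_derivative_iff_has_vector_derivative)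
  qed
  have "Ck_on k I (\<lambda>x. Re (g (of_real x)))" if "g holomorphic_on \<Omega>" for k g
    using that
  proof (induction k arbitrary: g)
    case 0
    then show ?case using der by (auto intro!: continuous_at_imp_continuous_on DERIV_isCont)
  next
    case (Suc k)
    have "Ck_on k I (\<lambda>x. frechet_derivative (\<lambda>x. Re (g (of_real x))) (at x) v)" for v
    proof (rule Ck_on_cong[OF assms(3)])
      show "Ck_on k I (\<lambda>x. Re ((\<lambda>z. deriv g z * of_real v) (of_real x)))"
        by (rule Suc.IH) (intro holomorphic_intros holomorphic_deriv Suc.prems assms)
      show "Re (deriv g (of_real x) * of_real v) = frechet_derivative (\<lambda>x. Re (g (of_real x))) (at x) v"
        if "x \<in> I" for x
        using frechet_derivative_at[OF der[OF Suc.prems that, unfolded has_field_derivative_def], symmetric]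
        by simp
    qed
    then show ?case using der[OF Suc.prems]
      by (auto simp: has_field_derivative_def differentiable_def)
  qed
  then show ?thesis using assms(1) by (simp add: smooth_on_def)
qed

lemma has_vector_derivative_nth:
  "(c has_vector_derivative v) F \<Longrightarrow> ((\<lambda>t. c t $ i) has_vector_derivative v $ i) F"
  by (rule bounded_linear.has_vector_derivative[OF bounded_linear_vec_nth])

lemma has_real_derivative_nth:
  "(c has_vector_derivative v) (at t) \<Longrightarrow> ((\<lambda>t. c t $ i :: real) has_real_derivative v $ i) (at t)"
  by (simp add: has_real_derivative_iff_has_vector_derivative has_vector_derivative_nth)

section \<open>\<open>F\<^sub>1\<close>-invariant graphs\<close>

locale F1_graph =
  fixes z1 :: real and F :: "real \<Rightarrow> real"
  assumes smooth: "smooth_on {z1<..} F"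
begin

definition M :: "(real^3) set" where
  "M = {vector [x, F z, z] | x z. z > z1}"

definition slope :: "real \<Rightarrow> real" where
  "slope z = exp (- z) * deriv F z"

text \<open>In the orthonormal frame \<open>exp z\<close> times the \<open>y\<close>-direction and
  the \<open>z\<close>-direction, the profile has direction \<open>(w, 1)\<close> with
  \<open>w\<close> the slope; this is the unit vector along \<open>(1, - w)\<close>. Its
  \<open>y\<close>-component is positive, which makes its product with \<open>sol_F2\<close>
  positive.\<close>

definition normal :: "real^3 \<Rightarrow> real^3" where
  "normal p = (1 / sqrt (1 + (slope (p$3))\<^sup>2)) *\<^sub>R vector [0, exp (p$3), - slope (p$3)]"

lemma mem_M: "p \<in> M \<longleftrightarrow> p$3 > z1 \<and> p$2 = F (p$3)"
proof
  assume "p$3 > z1 \<and> p$2 = F (p$3)"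
  then have "p = vector [p$1, F (p$3), p$3]" "p$3 > z1" by (auto simp: vec_eq_iff forall_3)
  then show "p \<in> M" unfolding M_def by blast
qed (auto simp: M_def)

lemma smooth_F': "smooth_on {z1<..} (deriv F)"
  using smooth_on_deriv(2)[OF smooth] by simp

lemma continuous_F': "continuous_on {z1<..} (deriv F)"
  using smooth_F' by (metis Ck_on.simps(1) smooth_on_def)

lemma deriv_F: "z > z1 \<Longrightarrow> (F has_real_derivative deriv F z) (at z)"
  and deriv_F': "z > z1 \<Longrightarrow> (deriv F has_real_derivative deriv (deriv F) z) (at z)"
  using smooth_on_deriv(1)[OF smooth] smooth_on_deriv(1)[OF smooth_F'] by simp_all

lemma F1_invariant_M: "F1_invariant M"
  unfolding F1_invariant_def
proof (intro allI set_eqI iffI)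
  fix t q assume "q \<in> M"
  then have "q = (\<lambda>p. vector [p$1 + t, p$2, p$3]) (vector [q$1 - t, q$2, q$3] :: real^3)"
    and "(vector [q$1 - t, q$2, q$3] :: real^3) \<in> M"
    by (auto simp: mem_M vec_eq_iff forall_3)
  then show "q \<in> (\<lambda>p. vector [p$1 + t, p$2, p$3]) ` M" by (rule image_eqI)
qed (auto simp: mem_M)

section \<open>Tangent spaces and the global chart\<close>

lemma velocity_tangent:
  assumes "(c has_vector_derivative v) (at t)" "open A" "t \<in> A" "c ` A \<subseteq> M"
  shows "v$2 = deriv F (c t $ 3) * v$3"
proof -
  have M: "c \<tau> \<in> M" if "\<tau> \<in> A" for \<tau> using that assms(4) by auto
  have "((\<lambda>\<tau>. F (c \<tau> $ 3)) has_real_derivative deriv F (c t $ 3) * v$3) (at t)"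
    by (rule DERIV_chain2[OF deriv_F has_real_derivative_nth[OF assms(1)]])
      (use M[OF assms(3)] in \<open>simp add: mem_M\<close>)
  \<comment> \<open>The equation \<open>c \<tau> $ 2 = F (c \<tau> $ 3)\<close> holds on the open
    set \<open>A\<close>, hence near \<open>t\<close>, so both sides have the same derivative there.
    A general open \<open>A\<close> covers piecewise paths away from their breakpoints.\<close>
  then have "((\<lambda>\<tau>. c \<tau> $ 2) has_real_derivative deriv F (c t $ 3) * v$3) (at t)"
    by (rule DERIV_cong_ev[THEN iffD1, rotated -1])
      (use M in \<open>auto simp: mem_M eventually_nhds intro!: exI[of _ A] assms(2,3)\<close>)
  then show ?thesis
    using has_real_derivative_nth[OF assms(1)] DERIV_unique by blast
qed

text \<open>The curve is the lift to the graph of a straight line in the \<open>(x, z)\<close>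
  half-plane. It realises tangent vectors as velocities and later serves as test path for the
  intrinsic distance.\<close>

lemma has_vector_derivative_lift:
  assumes "z1 < p$3 + t * v$3"
  shows "((\<lambda>t. vector [p$1 + t * v$1, F (p$3 + t * v$3), p$3 + t * v$3] :: real^3)
    has_vector_derivative vector [v$1, deriv F (p$3 + t * v$3) * v$3, v$3]) (at t)"
proof -
  have "((\<lambda>t. F (p$3 + t * v$3)) has_real_derivative deriv F (p$3 + t * v$3) * v$3) (at t)"
  proof (rule DERIV_chain2[where f = F and g = "\<lambda>t. p$3 + t * v$3"])
    show "((\<lambda>t. p$3 + t * v$3) has_real_derivative v$3) (at t)"
      by (auto intro!: derivative_eq_intros)
  qed (rule deriv_F[OF assms])
  then have "((\<lambda>t. vector [p$1, 0, p$3] + t *\<^sub>R vector [v$1, 0, v$3] + F (p$3 + t * v$3) *\<^sub>R axis 2 1)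
      has_vector_derivative 0 + 1 *\<^sub>R vector [v$1, 0, v$3]
        + (deriv F (p$3 + t * v$3) * v$3) *\<^sub>R (axis 2 1 :: real^3)) (at t)"
    unfolding has_real_derivative_iff_has_vector_derivative
    by (intro has_vector_derivative_add has_vector_derivative_const
        bounded_linear.has_vector_derivative[OF bounded_linear_scaleR_left]
        has_vector_derivative_id)
  moreover have "vector [a, 0, b] + x *\<^sub>R vector [a', 0, b'] + y *\<^sub>R axis 2 1
      = (vector [a + x * a', y, b + x * b'] :: real^3)" for a a' b b' x y
    by (simp add: vec_eq_iff forall_3 axis_def)
  moreover have "0 + 1 *\<^sub>R vector [a, 0, b] + y *\<^sub>R axis 2 1 = (vector [a, y, b] :: real^3)" for a b y
    by (simp add: vec_eq_iff forall_3 axis_def)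
  ultimately show ?thesis by simp
qed

lemma tangent_space_M:
  assumes "p \<in> M"
  shows "tangent_space M p = {v. v$2 = deriv F (p$3) * v$3}"
proof (intro set_eqI iffI)
  fix v assume "v \<in> tangent_space M p"
  then obtain e c where "e > 0" "c ` {-e<..<e} \<subseteq> M" "c 0 = p" "(c has_vector_derivative v) (at 0)"
    by (auto simp: tangent_space_def)
  then show "v \<in> {v. v$2 = deriv F (p$3) * v$3}"
    using velocity_tangent[of c v 0 "{-e<..<e}"] by simp
next
  fix v :: "real^3" assume "v \<in> {v. v$2 = deriv F (p$3) * v$3}"
  then have v: "v$2 = deriv F (p$3) * v$3" by simp
  define c where "c t = (vector [p$1 + t * v$1, F (p$3 + t * v$3), p$3 + t * v$3] :: real^3)" for t
  \<comment> \<open>This radius keeps the \<open>z\<close>-coordinate of the line above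
    \<open>z1\<close>; the summand 1 keeps the denominator positive when
    \<open>v$3 = 0\<close>.\<close>
  define e where "e = (p$3 - z1) / (\<bar>v$3\<bar> + 1)"
  have p: "p$3 > z1" using assms by (simp add: mem_M)
  then have e: "e > 0" by (simp add: e_def)
  have dom: "z1 < p$3 + t * v$3" if "t \<in> {-e<..<e}" for t
  proof -
    have "\<bar>t * v$3\<bar> \<le> \<bar>t\<bar> * (\<bar>v$3\<bar> + 1)" by (simp add: abs_mult algebra_simps)
    also have "\<dots> < e * (\<bar>v$3\<bar> + 1)" using that by (intro mult_strict_right_mono) auto
    also have "\<dots> = p$3 - z1" by (simp add: e_def)
    finally show ?thesis by linarith
  qed
  have "smooth_on {-e<..<e} c"
    by (rule smooth_on_compose_affine[OF smooth, where r = "p$3" and L = "\<lambda>t. t * v$3"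
          and a = "vector [p$1, 0, p$3]" and N = "\<lambda>t. t *\<^sub>R vector [v$1, 0, v$3]" and b = "axis 2 1"])
      (use dom in \<open>auto simp: c_def vec_eq_iff forall_3 axis_def bounded_linear_mult_left
        bounded_linear_scaleR_left\<close>)
  moreover have "c ` {-e<..<e} \<subseteq> M" using dom by (auto simp: c_def mem_M)
  moreover have "c 0 = p" using assms by (auto simp: c_def mem_M vec_eq_iff forall_3)
  moreover have "(c has_vector_derivative v) (at 0)"
  proof -
    have "vector [v$1, deriv F (p$3) * v$3, v$3] = v" using v by (simp add: vec_eq_iff forall_3)
    then show ?thesis using has_vector_derivative_lift[of p 0 v] p by (simp add: c_def[abs_def])
  qed
  ultimately show "v \<in> tangent_space M p" unfolding tangent_space_def using e by blast
qed

text \<open>A single chart suffices: \<open>X\<close> parametrises the graph by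
  \<open>(x, z)\<close>, and its inverse is the restriction of the linear projection
  \<open>Y\<close>, hence continuous.\<close>

lemma smooth_surface_M: "smooth_surface M"
  unfolding smooth_surface_def
proof
  fix p assume "p \<in> M"
  define U where "U = {u :: real^2. u$2 > z1}"
  define X where "X u = (vector [u$1, F (u$2), u$2] :: real^3)" for u :: "real^2"
  define Y where "Y p = (vector [p$1, p$3] :: real^2)" for p :: "real^3"
  define N where "N u = (vector [u$1, 0, u$2] :: real^3)" for u :: "real^2"
  have "linear N" by (rule linearI) (auto simp: N_def vec_eq_iff forall_3)
  then have N: "bounded_linear N" by (simp add: linear_conv_bounded_linear)
  have "linear Y" by (rule linearI) (auto simp: Y_def vec_eq_iff forall_2)
  then have Y: "continuous_on S Y" for S by (simp add: linear_continuous_on linear_conv_bounded_linear)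
  have "smooth_on U X"
    by (rule smooth_on_compose_affine[OF smooth _ _ N, where r = 0 and L = "\<lambda>u. u$2"
          and a = 0 and b = "axis 2 1"])
      (auto simp: U_def X_def N_def vec_eq_iff forall_3 axis_def bounded_linear_vec_nth
        intro: open_halfspace_component_gt_cart)
  moreover have "open U" unfolding U_def by (rule open_halfspace_component_gt_cart)
  moreover have "homeomorphism U (M \<inter> UNIV) X Y"
  proof (rule homeomorphismI)
    show "continuous_on U X" using \<open>smooth_on U X\<close> by (metis Ck_on.simps(1) smooth_on_def)
    show "continuous_on (M \<inter> UNIV) Y" by (rule Y)
  qed (auto simp: U_def X_def Y_def mem_M vec_eq_iff forall_2 forall_3)
  \<comment> \<open>Differentiating \<open>Y \<circ> X = id\<close>, where \<open>Y\<close> is its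
    own derivative, exhibits a left inverse of the derivative of \<open>X\<close>.\<close>
  moreover have "inj (frechet_derivative X (at u))" if "u \<in> U" for u
  proof -
    have "X differentiable at u"
      using \<open>smooth_on U X\<close> that by (metis Ck_on.simps(2) smooth_on_def)
    then have "(X has_derivative frechet_derivative X (at u)) (at u)"
      by (simp add: frechet_derivative_works)
    moreover have "(Y has_derivative Y) (at (X u))"
      using \<open>linear Y\<close> by (simp add: bounded_linear_imp_has_derivative linear_conv_bounded_linear)
    ultimately have "((Y \<circ> X) has_derivative Y \<circ> frechet_derivative X (at u)) (at u)"
      by (rule diff_chain_at)
    moreover have "Y \<circ> X = id" by (auto simp: Y_def X_def fun_eq_iff vec_eq_iff forall_2)
    ultimately have "Y \<circ> frechet_derivative X (at u) = id"
      using has_derivative_unique has_derivative_id by metis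
    then show ?thesis by (metis inj_on_id inj_on_imageI2)
  qed
  ultimately show "\<exists>(U::(real^2) set) W X Y. open U \<and> open W \<and> p \<in> W \<and> smooth_on U X \<and>
      homeomorphism U (M \<inter> W) X Y \<and> (\<forall>u\<in>U. inj (frechet_derivative X (at u)))"
    by (intro exI[of _ U] exI[of _ UNIV] exI[of _ X] exI[of _ Y]) auto
qed

text \<open>The induced metric has no mixed term in the coordinates \<open>x\<close>,
  \<open>z\<close>, and \<open>exp (- 2 * z)\<close> times the square of \<open>deriv F z\<close> is
  the square of the slope. The trace and the length estimates rest on this diagonal form.\<close>

lemma metric_tangent:
  assumes "u$2 = deriv F (p$3) * u$3" "v$2 = deriv F (p$3) * v$3"
  shows "sol_metric p u v = exp (2 * p$3) * (u$1 * v$1) + (1 + (slope (p$3))\<^sup>2) * (u$3 * v$3)"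
  using assms by (simp add: sol_metric_def slope_def power2_eq_square algebra_simps flip: exp_add)

lemma unit_normal: "sol_unit_normal M normal"
  unfolding sol_unit_normal_def
proof (intro conjI ballI)
  from continuous_F' have "continuous_on M (\<lambda>p. deriv F (p$3))"
    by (rule continuous_on_compose2) (auto simp: mem_M intro!: continuous_intros)
  then have sl: "continuous_on M (\<lambda>p. slope (p$3))"
    by (auto simp: slope_def intro!: continuous_intros)
  have "normal = (\<lambda>p. (1 / sqrt (1 + (slope (p$3))\<^sup>2)) *\<^sub>R
      (exp (p$3) *\<^sub>R axis 2 1 - slope (p$3) *\<^sub>R axis 3 1))"
    by (auto simp: normal_def fun_eq_iff vec_eq_iff forall_3 axis_def)
  then show "continuous_on M normal"
    by (auto intro!: continuous_intros sl simp: add_nonneg_eq_0_iff)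
next
  fix p :: "real^3"
  define r where "r = sqrt (1 + (slope (p$3))\<^sup>2)"
  have r: "r > 0" "r * r = 1 + (slope (p$3))\<^sup>2" by (auto simp: r_def add_pos_nonneg)
  have "sol_metric p (normal p) (normal p) = 1 / (r * r) + (slope (p$3))\<^sup>2 / (r * r)"
    by (simp add: sol_metric_def normal_def r_def[symmetric] flip: exp_add)
      (simp add: power2_eq_square)
  also have "\<dots> = (1 + (slope (p$3))\<^sup>2) / (r * r)" by (rule add_divide_distrib[symmetric])
  finally have "sol_metric p (normal p) (normal p) = (1 + (slope (p$3))\<^sup>2) / (r * r)" .
  then show "sol_metric p (normal p) (normal p) = 1" using r by (metis divide_self mult_pos_pos less_irrefl)
  fix v assume "p \<in> M" "v \<in> tangent_space M p"
  then have "v$2 = deriv F (p$3) * v$3" by (simp add: tangent_space_M)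
  then show "sol_metric p (normal p) v = 0"
    by (simp add: sol_metric_def normal_def r_def[symmetric] slope_def flip: exp_add mult.assoc)
qed

section \<open>Second fundamental form and mean curvature\<close>

lemma tangent_extension_exists:
  assumes "p \<in> M" "t \<in> tangent_space M p"
  shows "\<exists>T. tangent_extension M p t T"
proof -
  \<comment> \<open>A witness for the choice made in \<open>sol_second_ff\<close>: components 1 and
    3 of \<open>t\<close> are frozen while component 2 follows \<open>deriv F\<close>, which makes
    sense on the ambient half-space \<open>W\<close>.\<close>
  define T where "T q = (vector [t$1, deriv F (q$3) * t$3, t$3] :: real^3)" for q :: "real^3"
  define W where "W = {q :: real^3. q$3 > z1}"
  have W: "open W" unfolding W_def by (rule open_halfspace_component_gt_cart)
  have "smooth_on W T"
    by (rule smooth_on_compose_affine[OF smooth_F', where r = 0 and L = "\<lambda>q. q$3"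
          and a = "vector [t$1, 0, t$3]" and N = "\<lambda>_. 0" and b = "t$3 *\<^sub>R axis 2 1"])
      (auto simp: W W_def[symmetric] T_def vec_eq_iff forall_3 axis_def bounded_linear_vec_nth, simp add: W_def)
  moreover have "T p = t" using assms by (simp add: tangent_space_M T_def vec_eq_iff forall_3)
  moreover have "T q \<in> tangent_space M q" if "q \<in> M \<inter> W" for q
    using that by (simp add: tangent_space_M T_def)
  ultimately have "tangent_extension M p t T"
    using W assms(1) unfolding tangent_extension_def W_def mem_M by blast
  then show ?thesis by blast
qed

text \<open>Only the tangency of \<open>T\<close> along a curve with velocity \<open>s\<close> is used: it determines the
  component of \<open>\<partial>\<^sub>s T\<close> normal to the surface.\<close>

lemma extension_derivative:
  assumes "p \<in> M" "s \<in> tangent_space M p" "tangent_extension M p t T"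
  shows "frechet_derivative T (at p) s $ 2
    = deriv (deriv F) (p$3) * s$3 * t$3 + deriv F (p$3) * frechet_derivative T (at p) s $ 3"
proof -
  obtain e c where c: "e > 0" "smooth_on {-e<..<e} c" "c ` {-e<..<e} \<subseteq> M" "c 0 = p"
      "(c has_vector_derivative s) (at 0)"
    using assms(2) by (auto simp: tangent_space_def)
  obtain W where W: "open W" "p \<in> W" "smooth_on W T" "\<And>q. q \<in> M \<inter> W \<Longrightarrow> T q \<in> tangent_space M q" "T p = t"
    using assms(3) by (auto simp: tangent_extension_def)
  \<comment> \<open>Tangency of \<open>T\<close> is known only inside \<open>W\<close>, so the curve
    is cut down to the open set of times at which it lies there.\<close>
  define A where "A = {-e<..<e} \<inter> c -` W"
  have "continuous_on {-e<..<e} c" using c(2) by (metis Ck_on.simps(1) smooth_on_def)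
  then have A: "open A" unfolding A_def using W(1) by (intro continuous_open_preimage) auto
  have "0 \<in> A" using c W by (simp add: A_def)
  have "T differentiable at p" using W(2,3) by (metis Ck_on.simps(2) smooth_on_def)
  then have "(T has_derivative frechet_derivative T (at p)) (at (c 0))"
    by (simp add: frechet_derivative_works c(4))
  from vector_derivative_diff_chain_within[OF c(5), of T, simplified] this
  have Tc: "((T \<circ> c) has_vector_derivative frechet_derivative T (at p) s) (at 0)"
    by (metis UNIV_I has_derivative_at_withinI)
  have "((\<lambda>\<tau>. deriv F (c \<tau> $ 3) * (T \<circ> c) \<tau> $ 3) has_real_derivative
      deriv (deriv F) (p$3) * s$3 * t$3 + frechet_derivative T (at p) s $ 3 * deriv F (p$3)) (at 0)"
    using DERIV_mult[OF DERIV_chain2[OF deriv_F' has_real_derivative_nth[OF c(5)]]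
        has_real_derivative_nth[OF Tc]] assms(1) by (simp add: c(4) W(5) mem_M)
  then have "((\<lambda>\<tau>. (T \<circ> c) \<tau> $ 2) has_real_derivative
      deriv (deriv F) (p$3) * s$3 * t$3 + frechet_derivative T (at p) s $ 3 * deriv F (p$3)) (at 0)"
  proof (rule DERIV_cong_ev[THEN iffD1, rotated -1])
    have "deriv F (c \<tau> $ 3) * (T \<circ> c) \<tau> $ 3 = (T \<circ> c) \<tau> $ 2" if "\<tau> \<in> A" for \<tau>
    proof -
      have "c \<tau> \<in> M" "c \<tau> \<in> W" using that c(3) by (auto simp: A_def)
      then show ?thesis using W(4)[of "c \<tau>"] by (simp add: tangent_space_M)
    qed
    then show "\<forall>\<^sub>F \<tau> in nhds 0. deriv F (c \<tau> $ 3) * (T \<circ> c) \<tau> $ 3 = (T \<circ> c) \<tau> $ 2"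
      using A \<open>0 \<in> A\<close> unfolding eventually_nhds by blast
  qed auto
  then show ?thesis
    using has_real_derivative_nth[OF Tc, of 2] DERIV_unique by fastforce
qed

text \<open>The extension chosen by \<open>SOME\<close> is unknown, but \<open>D$1\<close> is
  annihilated by the normal, and by \<open>extension_derivative\<close> the part of
  \<open>D$2\<close> containing \<open>D$3\<close> cancels against the contribution of
  \<open>D$3\<close> itself. What remains depends on \<open>s\<close> and \<open>t\<close>
  only.\<close>

lemma second_ff:
  assumes "p \<in> M" "s \<in> tangent_space M p" "t \<in> tangent_space M p"
  defines "w \<equiv> slope (p$3)"
  shows "sol_second_ff M normal p s t =
    ((exp (- (p$3)) * deriv (deriv F) (p$3) - 2 * w - w ^ 3) * (s$3 * t$3)
      + w * (exp (2 * p$3) * (s$1 * t$1))) / sqrt (1 + w\<^sup>2)"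
proof -
  define T where "T = (SOME T. tangent_extension M p t T)"
  have T: "tangent_extension M p t T"
    unfolding T_def using tangent_extension_exists[OF assms(1,3)] by (rule someI_ex)
  then have Tp: "T p = t" by (simp add: tangent_extension_def)
  define D where "D = frechet_derivative T (at p) s"
  define E where "E = exp (p$3)"
  have E: "E > 0" "exp (- (p$3)) = 1 / E" "exp (2 * p$3) = E\<^sup>2" "exp (- (2 * p$3)) = 1 / E\<^sup>2"
    by (auto simp: E_def exp_minus exp_double inverse_eq_divide)
  have F': "deriv F (p$3) = E * w" using E(1) by (simp add: w_def slope_def E(2))
  have D: "D$2 = deriv (deriv F) (p$3) * s$3 * t$3 + E * w * D$3"
    using extension_derivative[OF assms(1,2) T] by (simp add: D_def F')
  have s: "s$2 = E * w * s$3" and t: "t$2 = E * w * t$3"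
    using assms(2,3) by (simp_all add: tangent_space_M[OF assms(1)] F')
  have "sol_second_ff M normal p s t = sol_metric p (D + vector [s$1 * t$3 + s$3 * t$1,
            - (s$2 * t$3) - s$3 * t$2,
            exp (- 2 * p$3) * s$2 * t$2 - exp (2 * p$3) * s$1 * t$1]) (normal p)"
    by (simp add: sol_second_ff_def T_def[symmetric] sol_nabla_eq Tp D_def)
  also have "\<dots> = ((1 / E\<^sup>2) * (D$2 - s$2 * t$3 - s$3 * t$2) * E
      - w * (D$3 + (1 / E\<^sup>2) * s$2 * t$2 - E\<^sup>2 * s$1 * t$1)) / sqrt (1 + w\<^sup>2)"
    by (simp add: sol_metric_def normal_def w_def[symmetric] E E_def[symmetric] diff_divide_distrib
        algebra_simps add_divide_distrib)
  also have "(1 / E\<^sup>2) * (D$2 - s$2 * t$3 - s$3 * t$2) * E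
      - w * (D$3 + (1 / E\<^sup>2) * s$2 * t$2 - E\<^sup>2 * s$1 * t$1)
    = (exp (- (p$3)) * deriv (deriv F) (p$3) - 2 * w - w ^ 3) * (s$3 * t$3)
      + w * (exp (2 * p$3) * (s$1 * t$1))"
    using E(1) unfolding D s t E(2,3) by (simp add: field_simps power2_eq_square power3_eq_cube)
  finally show ?thesis .
qed

text \<open>A weighted form of the fact that a square matrix with orthonormal rows has columns of
  unit length. It lets the trace be computed in whichever orthonormal basis \<open>SOME\<close>
  picks.\<close>

lemma orthonormal_columns:
  fixes P Q a b c d :: real
  assumes "P * (a * a) + Q * (b * b) = 1" "P * (c * c) + Q * (d * d) = 1" "P * (a * c) + Q * (b * d) = 0"
  shows "P * (a * a + c * c) = 1" "Q * (b * b + d * d) = 1"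
proof -
  define x y where "x = P * (a * a)" and "y = P * (c * c)"
  have q: "Q * (b * b) = 1 - x" "Q * (d * d) = 1 - y" using assms(1,2) by (simp_all add: x_def y_def)
  have "P * (a * c) = - (Q * (b * d))" using assms(3) by linarith
  then have "(P * (a * c)) * (P * (a * c)) = (Q * (b * d)) * (Q * (b * d))"
    by (simp only: minus_mult_minus)
  then have "x * y = (Q * (b * b)) * (Q * (d * d))" unfolding x_def y_def by (simp only: mult_ac)
  \<comment> \<open>Squaring the orthogonality relation has given an identity whose quadratic terms
    cancel, leaving \<open>x + y = 1\<close>.\<close>
  then have "x * y = (1 - x) * (1 - y)" by (simp only: q)
  then have "x + y = 1" by (simp add: algebra_simps)
  with q show "P * (a * a + c * c) = 1" "Q * (b * b + d * d) = 1"
    unfolding distrib_left x_def[symmetric] y_def[symmetric] by simp_all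
qed

text \<open>The \<open>x\<close>-direction and the profile direction are orthogonal, so it is enough
  to normalise them. Existence ensures that \<open>SOME\<close> in \<open>sol_mean_curvature\<close>
  denotes an actual basis.\<close>

lemma orthonormal_basis_exists:
  assumes "p \<in> M"
  shows "\<exists>b. sol_orthonormal_basis M p b"
proof -
  define r where "r = sqrt (1 + (slope (p$3))\<^sup>2)"
  have r: "r > 0" "r * r = 1 + (slope (p$3))\<^sup>2" by (auto simp: r_def add_pos_nonneg)
  define e1 where "e1 = (vector [exp (- (p$3)), 0, 0] :: real^3)"
  define e2 where "e2 = (vector [0, deriv F (p$3) / r, 1 / r] :: real^3)"
  have t: "e1$2 = deriv F (p$3) * e1$3" "e2$2 = deriv F (p$3) * e2$3"
    by (simp_all add: e1_def e2_def)
  have "sol_orthonormal_basis M p (e1, e2)"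
    using r t by (simp add: sol_orthonormal_basis_def tangent_space_M[OF assms] metric_tangent)
      (simp add: e1_def e2_def flip: exp_add r(2))
  then show ?thesis ..
qed

text \<open>The metric and the second fundamental form are both diagonal in \<open>x\<close> and
  \<open>z\<close>, so \<open>orthonormal_columns\<close> evaluates the trace as the sum of the two
  quotients of diagonal coefficients.\<close>

lemma mean_curvature:
  assumes "p \<in> M"
  defines "w \<equiv> slope (p$3)"
  shows "sol_mean_curvature M normal p =
    exp (- (p$3)) * (deriv (deriv F) (p$3) - deriv F (p$3)) / ((1 + w\<^sup>2) * sqrt (1 + w\<^sup>2))"
proof -
  obtain e1 e2 where b: "(SOME b. sol_orthonormal_basis M p b) = (e1, e2)" by fastforce
  then have "sol_orthonormal_basis M p (e1, e2)"
    using orthonormal_basis_exists[OF assms(1)] by (metis someI_ex)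
  then have e: "e1 \<in> tangent_space M p" "e2 \<in> tangent_space M p"
    and "sol_metric p e1 e1 = 1" "sol_metric p e2 e2 = 1" "sol_metric p e1 e2 = 0"
    by (simp_all add: sol_orthonormal_basis_def)
  then have "exp (2 * p$3) * (e1$1 * e1$1) + (1 + w\<^sup>2) * (e1$3 * e1$3) = 1"
    "exp (2 * p$3) * (e2$1 * e2$1) + (1 + w\<^sup>2) * (e2$3 * e2$3) = 1"
    "exp (2 * p$3) * (e1$1 * e2$1) + (1 + w\<^sup>2) * (e1$3 * e2$3) = 0"
    by (simp_all add: tangent_space_M[OF assms(1)] metric_tangent w_def)
  note o = orthonormal_columns[OF this]
  define B where "B = exp (- (p$3)) * deriv (deriv F) (p$3) - 2 * w - w ^ 3"
  define r where "r = sqrt (1 + w\<^sup>2)"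
  define q where "q = e1$3 * e1$3 + e2$3 * e2$3"
  have pos: "1 + w\<^sup>2 > 0" by (simp add: add_pos_nonneg)
  have q: "q = 1 / (1 + w\<^sup>2)" using o(2) pos by (simp add: q_def field_simps)
  have "sol_mean_curvature M normal p = (B * (e1$3 * e1$3) + w * (exp (2 * p$3) * (e1$1 * e1$1))) / r
      + (B * (e2$3 * e2$3) + w * (exp (2 * p$3) * (e2$1 * e2$1))) / r"
    by (simp add: sol_mean_curvature_def b second_ff[OF assms(1) e(1) e(1)] second_ff[OF assms(1) e(2) e(2)]
        B_def r_def w_def)
  also have "\<dots> = (B * q + w * (exp (2 * p$3) * (e1$1 * e1$1 + e2$1 * e2$1))) / r"
    by (simp add: q_def add_divide_distrib algebra_simps)
  also have "\<dots> = (B / (1 + w\<^sup>2) + w) / r" by (simp add: o(1) q)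
  \<comment> \<open>The sum of \<open>- 2 * w - w ^ 3\<close> and \<open>w * (1 + w ^ 2)\<close>
    collapses to \<open>- w\<close>, and \<open>exp (- z) * deriv (deriv F) z - w\<close> is the
    derivative of the slope.\<close>
  also have "B / (1 + w\<^sup>2) + w = exp (- (p$3)) * (deriv (deriv F) (p$3) - deriv F (p$3)) / (1 + w\<^sup>2)"
    using pos by (simp add: B_def field_simps power2_eq_square power3_eq_cube) (simp add: w_def slope_def)
  finally show ?thesis by (simp add: r_def)
qed

text \<open>The derivative of \<open>slope\<close> is
  \<open>exp (- z) * (deriv (deriv F) z - deriv F z)\<close>, so the hypothesis is the equation
  \<open>w' = exp (- z) * (1 + w ^ 2)\<close> multiplied by \<open>exp z\<close>.\<close>

lemma translator_F2:
  assumes "\<And>z. z > z1 \<Longrightarrow> deriv (deriv F) z - deriv F z = 1 + (slope z)\<^sup>2"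
  shows "sol_translator sol_F2 M"
  unfolding sol_translator_def
proof (intro conjI exI[of _ normal] ballI smooth_surface_M unit_normal)
  fix p assume p: "p \<in> M"
  have "1 + (slope (p$3))\<^sup>2 > 0" by (simp add: add_pos_nonneg)
  then show "sol_mean_curvature M normal p = sol_metric p (normal p) (sol_F2 p)"
    using p assms[of "p$3"]
    by (simp add: mean_curvature mem_M) (simp add: sol_metric_def normal_def sol_F2_def field_simps flip: exp_add)
qed

subsection \<open>Completeness\<close>

text \<open>Integrate the derivative of \<open>f \<circ> c\<close> and compare the integrand with
  the speed of \<open>c\<close>. Functions that are 1-Lipschitz in this infinitesimal sense thus
  bound the intrinsic distance from below.\<close>

lemma length_lower_bound:
  assumes "c piecewise_C1_differentiable_on {0..1}" "path_image c \<subseteq> M"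
    and der: "\<And>p. p \<in> M \<Longrightarrow> (f has_derivative f' p) (at p)"
    and le: "\<And>p v. p \<in> M \<Longrightarrow> v$2 = deriv F (p$3) * v$3 \<Longrightarrow> \<bar>f' p v\<bar> \<le> sqrt (sol_metric p v v)"
  shows "ennreal \<bar>f (pathfinish c) - f (pathstart c)\<bar> \<le> sol_length c"
proof (cases "sol_length c = \<infinity>")
  case False
  from assms(1) obtain S D where S: "finite S" "continuous_on {0..1} c" "continuous_on ({0..1} - S) D"
      "\<And>t. t \<in> {0..1} - S \<Longrightarrow> (c has_vector_derivative D t) (at t)"
    by (auto simp: piecewise_C1_differentiable_on_def C1_differentiable_on_def)
  have M: "c t \<in> M" if "t \<in> {0..1}" for t
    using assms(2) that by (auto simp: path_image_def)
  define A where "A = {0<..<1} - S"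
  have A: "open A" unfolding A_def using S(1) by (intro open_Diff finite_imp_closed) auto
  have A01: "A \<subseteq> {0..1}" "A \<subseteq> {0..1} - S" by (auto simp: A_def)
  have tangent: "D t $ 2 = deriv F (c t $ 3) * D t $ 3" if "t \<in> A" for t
    by (rule velocity_tangent[OF _ A that]) (use S(4)[of t] A01 that M in auto)
  \<comment> \<open>Cutting the speed off outside the open set \<open>A\<close>, on which it is
    continuous, makes it Borel measurable.\<close>
  define g where "g t = indicat_real A t *\<^sub>R sqrt (sol_metric (c t) (D t) (D t))" for t
  have "continuous_on A (\<lambda>t. sqrt (sol_metric (c t) (D t) (D t)))"
    unfolding sol_metric_def
    by (intro continuous_intros continuous_on_subset[OF S(2)] continuous_on_subset[OF S(3)] A01)
  then have g_meas: "g \<in> borel_measurable borel"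
    unfolding g_def using A by (intro borel_measurable_continuous_on_indicator) auto
  have metric_nonneg: "sol_metric p v v \<ge> 0" for p v by (simp add: sol_metric_def mult.assoc)
  have g_nonneg: "g t \<ge> 0" for t by (simp add: g_def metric_nonneg)
  \<comment> \<open>The unit interval differs from \<open>A\<close> only in breakpoints and
    endpoints, a null set, so replacing the integrand by \<open>g\<close> preserves the
    length.\<close>
  have "AE t in lborel. t \<notin> S \<union> {0, 1}"
    by (intro AE_not_in countable_imp_null_set_lborel countable_finite) (simp add: S(1))
  then have "AE t in lborel. ennreal (sqrt (sol_metric (c t) (vector_derivative c (at t))
      (vector_derivative c (at t)))) * indicator {0..1} t = ennreal (g t)"
  proof eventually_elim
    case (elim t)
    show ?case
    proof (cases "t \<in> A")
      case True
      then have "vector_derivative c (at t) = D t" using S(4)[of t] A01 by (auto intro!: vector_derivative_at)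
      then show ?thesis using True A01 by (auto simp: g_def)
    next
      case False
      then have "t \<notin> {0..1}" using elim by (auto simp: A_def)
      then show ?thesis using False by (simp add: g_def)
    qed
  qed
  then have len: "sol_length c = (\<integral>\<^sup>+t. ennreal (g t) \<partial>lborel)"
    unfolding sol_length_def by (rule nn_integral_cong_AE)
  with False obtain r where r: "r \<ge> 0" "sol_length c = ennreal r"
    by (cases "sol_length c") auto
  have "(g has_integral r) UNIV"
    by (rule nn_integral_has_integral[OF g_meas g_nonneg]) (use r len in simp_all)
  moreover have "(\<lambda>t. if t \<in> {0..1} then g t else 0) = g"
    using A01 by (auto simp: g_def fun_eq_iff indicator_def)
  ultimately have "((\<lambda>t. if t \<in> {0..1} then g t else 0) has_integral r) UNIV" by (simp only:)
  then have g: "(g has_integral r) {0..1}" by (simp only: has_integral_restrict_UNIV)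
  define d where "d t = (if t \<in> A then f' (c t) (D t) else 0)" for t
  have "continuous_on M f" using der by (meson continuous_at_imp_continuous_on has_derivative_continuous)
  then have "continuous_on {0..1} (\<lambda>t. f (c t))"
    by (rule continuous_on_compose2[OF _ S(2)]) (use M in auto)
  moreover have "((\<lambda>t. f (c t)) has_vector_derivative d t) (at t)" if "t \<in> {0<..<1} - S" for t
  proof -
    have t: "t \<in> A" using that by (simp add: A_def)
    have "((f \<circ> c) has_vector_derivative f' (c t) (D t)) (at t)"
    proof (rule vector_derivative_diff_chain_within)
      show "(c has_vector_derivative D t) (at t)" using S(4) t A01 by blast
      show "(f has_derivative f' (c t)) (at (c t) within range c)"
        using der[OF M] t A01 by (blast intro: has_derivative_at_withinI)
    qed
    then show ?thesis using t by (simp add: d_def o_def)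
  qed
  ultimately have d: "(d has_integral f (c 1) - f (c 0)) {0..1}"
    by (intro fundamental_theorem_of_calculus_interior_strong[OF S(1)]) auto
  have "norm (d t) \<le> g t" for t
    using le[OF M tangent, of t] A01 by (auto simp: d_def g_def)
  then have "norm (integral {0..1} d) \<le> integral {0..1} g"
    using d g by (intro integral_norm_bound_integral) auto
  then have "\<bar>f (c 1) - f (c 0)\<bar> \<le> r" using d g by (simp add: integral_unique)
  then show ?thesis using r by (simp add: pathfinish_def pathstart_def ennreal_leI)
next
  case True
  show ?thesis unfolding True by (simp only: infinity_ennreal_def top_greatest)
qed

lemma dist_lower_bound:
  assumes "\<And>p. p \<in> M \<Longrightarrow> (f has_derivative f' p) (at p)"
    and "\<And>p v. p \<in> M \<Longrightarrow> v$2 = deriv F (p$3) * v$3 \<Longrightarrow> \<bar>f' p v\<bar> \<le> sqrt (sol_metric p v v)"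
  shows "ennreal \<bar>f q - f p\<bar> \<le> sol_intrinsic_dist M p q"
  unfolding sol_intrinsic_dist_def
proof (rule INF_greatest)
  fix c
  assume "c \<in> {c. c piecewise_C1_differentiable_on {0..1} \<and> path_image c \<subseteq> M \<and>
    pathstart c = p \<and> pathfinish c = q}"
  then have c: "c piecewise_C1_differentiable_on {0..1}" "path_image c \<subseteq> M"
    and ends: "pathstart c = p" "pathfinish c = q" by simp_all
  show "ennreal \<bar>f q - f p\<bar> \<le> sol_length c"
    using length_lower_bound[where f = f and f' = f', OF c] assms by (simp only: ends)
qed

text \<open>The test path is the lift of the straight segment in the coordinates \<open>x\<close>,
  \<open>z\<close>. By convexity it stays in the strip, where \<open>B\<close> bounds the factors of
  \<open>dx\<close> and \<open>dz\<close> in its speed.\<close>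

lemma dist_upper_bound:
  assumes "p \<in> M" "q \<in> M" "p$3 \<in> {a..b}" "q$3 \<in> {a..b}" "z1 < a"
    and B: "\<And>z. z \<in> {a..b} \<Longrightarrow> exp z \<le> B \<and> sqrt (1 + (slope z)\<^sup>2) \<le> B"
  shows "sol_intrinsic_dist M p q \<le> ennreal (B * (\<bar>q$1 - p$1\<bar> + \<bar>q$3 - p$3\<bar>))"
proof -
  define v where "v = q - p"
  define c where "c t = (vector [p$1 + t * v$1, F (p$3 + t * v$3), p$3 + t * v$3] :: real^3)" for t
  define D where "D t = (vector [v$1, deriv F (p$3 + t * v$3) * v$3, v$3] :: real^3)" for t
  define C where "C = B * (\<bar>q$1 - p$1\<bar> + \<bar>q$3 - p$3\<bar>)"
  have z: "p$3 + t * v$3 \<in> {a..b}" if "t \<in> {0..1}" for t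
    using convexD_alt[OF convex_real_interval(5) assms(3,4), of t] that
    by (simp add: v_def algebra_simps)
  have der: "(c has_vector_derivative D t) (at t)" if "t \<in> {0..1}" for t
    unfolding c_def D_def by (rule has_vector_derivative_lift) (use z[OF that] assms(5) in auto)
  from continuous_F' have "continuous_on {0..1} (\<lambda>t. deriv F (p$3 + t * v$3))"
    by (rule continuous_on_compose2) (use z assms(5) in \<open>force intro!: continuous_intros\<close>)+
  moreover have "D = (\<lambda>t. vector [v$1, 0, v$3] + (deriv F (p$3 + t * v$3) * v$3) *\<^sub>R axis 2 1)"
    by (simp add: D_def fun_eq_iff vec_eq_iff forall_3 axis_def)
  ultimately have "continuous_on {0..1} D" by (auto intro!: continuous_intros)
  then have "c C1_differentiable_on {0..1}" unfolding C1_differentiable_on_def using der by blast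
  then have "c piecewise_C1_differentiable_on {0..1}" by (rule C1_differentiable_imp_piecewise)
  moreover have "path_image c \<subseteq> M"
    using z assms(5) by (force simp: path_image_def c_def mem_M)
  moreover have "pathstart c = p" "pathfinish c = q"
    using assms(1,2) by (auto simp: pathstart_def pathfinish_def c_def v_def mem_M vec_eq_iff forall_3)
  ultimately have "sol_intrinsic_dist M p q \<le> sol_length c"
    unfolding sol_intrinsic_dist_def by (intro INF_lower) auto
  also have "\<dots> \<le> (\<integral>\<^sup>+(t::real). ennreal C * indicator {0..1} t \<partial>lborel)"
    unfolding sol_length_def
  proof (rule nn_integral_mono)
    fix t :: real
    have "sqrt (sol_metric (c t) (vector_derivative c (at t)) (vector_derivative c (at t))) \<le> C"
      if t: "t \<in> {0..1}"
    proof -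
      define z where "z = p$3 + t * v$3"
      have zab: "z \<in> {a..b}" unfolding z_def using t by (rule z)
      have c3: "c t $ 3 = z" by (simp add: c_def z_def)
      have "sol_metric (c t) (D t) (D t)
          = (exp z * v$1)\<^sup>2 + (sqrt (1 + (slope z)\<^sup>2) * v$3)\<^sup>2"
        by (subst metric_tangent) (simp_all add: c3 D_def z_def[symmetric] power_mult_distrib
            add_pos_nonneg exp_double power2_eq_square)
      also have "\<dots> \<le> (\<bar>exp z * v$1\<bar> + \<bar>sqrt (1 + (slope z)\<^sup>2) * v$3\<bar>)\<^sup>2"
        by (simp add: power2_sum)
      finally have "sqrt (sol_metric (c t) (D t) (D t)) \<le> \<bar>exp z * v$1\<bar> + \<bar>sqrt (1 + (slope z)\<^sup>2) * v$3\<bar>"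
        by (intro real_le_lsqrt) auto
      also have "\<dots> \<le> B * \<bar>v$1\<bar> + B * \<bar>v$3\<bar>"
        using B[OF zab] by (auto simp: abs_mult intro!: add_mono mult_right_mono)
      also have "\<dots> = C" by (simp add: C_def v_def distrib_left)
      finally show ?thesis using vector_derivative_at[OF der[OF t]] by simp
    qed
    then show "ennreal (sqrt (sol_metric (c t) (vector_derivative c (at t)) (vector_derivative c (at t))))
        * indicator {0..1} t \<le> ennreal C * indicator {0..1} t"
      by (auto simp: indicator_def intro!: ennreal_leI)
  qed
  also have "\<dots> = ennreal C" by (subst nn_integral_cmult_indicator) auto
  finally show ?thesis by (simp add: C_def)
qed

text \<open>The function \<open>h\<close> witnesses that the profile curve has infinite length near \<open>z = z\<^sub>1\<close>.\<close>

lemma complete: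
  assumes h: "\<And>z. z > z1 \<Longrightarrow> (h has_real_derivative h' z) (at z)"
    and h': "\<And>z. z > z1 \<Longrightarrow> \<bar>h' z\<bar> \<le> sqrt (1 + (slope z)\<^sup>2)"
    and lim: "filterlim h at_bot (at_right z1)"
  shows "sol_complete M"
  unfolding sol_complete_def
proof (intro allI impI, elim conjE)
  fix \<sigma> :: "nat \<Rightarrow> real^3"
  assume "range \<sigma> \<subseteq> M"
    and cau: "\<forall>e>0. \<exists>N. \<forall>m\<ge>N. \<forall>n\<ge>N. sol_intrinsic_dist M (\<sigma> m) (\<sigma> n) < e"
  then have M: "\<sigma> n \<in> M" for n by auto
  \<comment> \<open>Along a Cauchy sequence every function that is 1-Lipschitz for the induced
    metric converges. This is applied to \<open>z\<close>, to \<open>exp z1 * x\<close> and to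
    \<open>h\<close>.\<close>
  have conv: "convergent (\<lambda>n. f (\<sigma> n))"
    if f: "\<And>p. p \<in> M \<Longrightarrow> (f has_derivative f' p) (at p)"
      "\<And>p v. p \<in> M \<Longrightarrow> v$2 = deriv F (p$3) * v$3 \<Longrightarrow> (f' p v)\<^sup>2
        \<le> exp (2 * p$3) * (v$1 * v$1) + (1 + (slope (p$3))\<^sup>2) * (v$3 * v$3)"
    for f :: "real^3 \<Rightarrow> real" and f'
  proof -
    have le: "\<bar>f' p v\<bar> \<le> sqrt (sol_metric p v v)" if "p \<in> M" "v$2 = deriv F (p$3) * v$3" for p v
      using f(2)[OF that] metric_tangent[OF that(2) that(2)] by (intro real_le_rsqrt) simp
    have bound: "ennreal \<bar>f q - f p\<bar> \<le> sol_intrinsic_dist M p q" for p q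
      by (rule dist_lower_bound[where f = f and f' = f']) (fact f(1) le)+
    have "Cauchy (\<lambda>n. f (\<sigma> n))"
    proof (rule CauchyI)
      fix e :: real assume "e > 0"
      then obtain N where N: "\<And>m n. m \<ge> N \<Longrightarrow> n \<ge> N \<Longrightarrow> sol_intrinsic_dist M (\<sigma> m) (\<sigma> n) < ennreal e"
        using cau by (metis ennreal_0 ennreal_less_iff order_refl)
      have "norm (f (\<sigma> m) - f (\<sigma> n)) < e" if "m \<ge> N" "n \<ge> N" for m n
      proof -
        have "ennreal \<bar>f (\<sigma> m) - f (\<sigma> n)\<bar> < ennreal e"
          using bound N[OF that(2,1)] by (rule le_less_trans)
        then show ?thesis by (simp add: ennreal_less_iff)
      qed
      then show "\<exists>N. \<forall>m\<ge>N. \<forall>n\<ge>N. norm (f (\<sigma> m) - f (\<sigma> n)) < e" by blast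
    qed
    then show ?thesis by (rule Cauchy_convergent)
  qed
  have nth: "((\<lambda>q::real^3. q$i) has_derivative (\<lambda>v. v$i)) (at p)" for i p
    by (rule bounded_linear_imp_has_derivative) (rule bounded_linear_vec_nth)
  have "convergent (\<lambda>n. \<sigma> n $ 3)"
  proof (rule conv[OF nth])
    fix p v :: "real^3"
    have "(v$3)\<^sup>2 \<le> (1 + (slope (p$3))\<^sup>2) * (v$3 * v$3)"
      by (simp add: power2_eq_square distrib_right)
    moreover have "exp (2 * p$3) * (v$1 * v$1) \<ge> 0" by simp
    ultimately show "(v$3)\<^sup>2 \<le> exp (2 * p$3) * (v$1 * v$1) + (1 + (slope (p$3))\<^sup>2) * (v$3 * v$3)"
      by linarith
  qed
  then obtain z where z: "(\<lambda>n. \<sigma> n $ 3) \<longlonglongrightarrow> z" by (auto simp: convergent_def)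
  \<comment> \<open>The speed is at least \<open>exp z\<close> times the absolute value of the
    \<open>x\<close>-velocity, and \<open>exp z > exp z1\<close> on the surface; hence the factor
    \<open>exp z1\<close>.\<close>
  have "convergent (\<lambda>n. exp z1 * \<sigma> n $ 1)"
  proof (rule conv[OF has_derivative_mult_right[OF nth]])
    fix p v :: "real^3" assume "p \<in> M"
    then have "(exp z1)\<^sup>2 \<le> exp (2 * p$3)" by (simp add: mem_M flip: exp_double)
    then have "(exp z1)\<^sup>2 * (v$1 * v$1) \<le> exp (2 * p$3) * (v$1 * v$1)"
      by (rule mult_right_mono) simp
    moreover have "(1 + (slope (p$3))\<^sup>2) * (v$3 * v$3) \<ge> 0" by simp
    ultimately show "(exp z1 * v$1)\<^sup>2
        \<le> exp (2 * p$3) * (v$1 * v$1) + (1 + (slope (p$3))\<^sup>2) * (v$3 * v$3)"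
      by (simp add: power2_eq_square mult_ac)
  qed
  then have "convergent (\<lambda>n. \<sigma> n $ 1)" by (simp add: convergent_mult_const_iff)
  then obtain x where x: "(\<lambda>n. \<sigma> n $ 1) \<longlonglongrightarrow> x" by (auto simp: convergent_def)
  have "convergent (\<lambda>n. h (\<sigma> n $ 3))"
  proof (rule conv)
    fix p :: "real^3" assume "p \<in> M"
    then have "(h has_derivative (*) (h' (p$3))) (at (p$3))"
      using h by (simp add: mem_M has_field_derivative_def)
    then show "((\<lambda>q. h (q$3)) has_derivative (\<lambda>v. h' (p$3) * v$3)) (at p)"
      by (rule has_derivative_compose[OF nth])
  next
    fix p v :: "real^3" assume "p \<in> M"
    then have "(h' (p$3))\<^sup>2 \<le> 1 + (slope (p$3))\<^sup>2"
      using h'[of "p$3"] by (metis mem_M abs_ge_zero power2_abs power_mono real_sqrt_pow2_iff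
          add_nonneg_nonneg zero_le_one zero_le_power2)
    then have "(h' (p$3))\<^sup>2 * (v$3 * v$3) \<le> (1 + (slope (p$3))\<^sup>2) * (v$3 * v$3)"
      by (rule mult_right_mono) simp
    moreover have "exp (2 * p$3) * (v$1 * v$1) \<ge> 0" by simp
    ultimately show "(h' (p$3) * v$3)\<^sup>2
        \<le> exp (2 * p$3) * (v$1 * v$1) + (1 + (slope (p$3))\<^sup>2) * (v$3 * v$3)"
      by (simp add: power2_eq_square mult_ac)
  qed
  then obtain L where L: "(\<lambda>n. h (\<sigma> n $ 3)) \<longlonglongrightarrow> L" by (auto simp: convergent_def)
  have "z \<ge> z1"
    by (rule LIMSEQ_le_const[OF z]) (use M in \<open>auto simp: mem_M intro!: exI[of _ 0] less_imp_le\<close>)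
  \<comment> \<open>Otherwise \<open>h (\<sigma> n $ 3)\<close> would diverge to minus infinity,
    although it converges to \<open>L\<close>.\<close>
  moreover have "z \<noteq> z1"
  proof
    assume "z = z1"
    then have "filterlim (\<lambda>n. \<sigma> n $ 3) (at_right z1) sequentially"
      using z M by (force simp: filterlim_at mem_M intro!: always_eventually)
    then have "filterlim (\<lambda>n. h (\<sigma> n $ 3)) at_bot sequentially" by (rule filterlim_compose[OF lim])
    then have "filterlim (\<lambda>n. h (\<sigma> n $ 3)) at_infinity sequentially"
      using filterlim_mono at_bot_le_at_infinity by blast
    then show False using L not_tendsto_and_filterlim_at_infinity by (metis sequentially_bot)
  qed
  ultimately have zz: "z1 < z" by simp
  define l where "l = (vector [x, F z, z] :: real^3)"
  have l: "l \<in> M" using zz by (simp add: l_def mem_M)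
  \<comment> \<open>The midpoint separates the limit from \<open>z1\<close>: the compact interval
    from \<open>a\<close> to \<open>z + 1\<close> lies in the domain and eventually contains
    \<open>\<sigma> n $ 3\<close>.\<close>
  define a where "a = (z1 + z) / 2"
  have a: "z1 < a" "a < z" using zz by (simp_all add: a_def)
  from continuous_F' have "continuous_on {a..z + 1} (deriv F)"
    by (rule continuous_on_subset) (use a in auto)
  then have "continuous_on {a..z + 1} (\<lambda>y. exp y + sqrt (1 + (slope y)\<^sup>2))"
    unfolding slope_def by (intro continuous_intros)
  then obtain B where B: "\<And>y. y \<in> {a..z + 1} \<Longrightarrow> exp y + sqrt (1 + (slope y)\<^sup>2) \<le> B"
    using continuous_attains_sup[of "{a..z + 1}" "\<lambda>y. exp y + sqrt (1 + (slope y)\<^sup>2)"] a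
    by fastforce
  have B': "exp y \<le> B \<and> sqrt (1 + (slope y)\<^sup>2) \<le> B" if "y \<in> {a..z + 1}" for y
  proof -
    have "sqrt (1 + (slope y)\<^sup>2) \<ge> 0" "exp y \<ge> 0" by simp_all
    then show ?thesis using B[OF that] by linarith
  qed
  have le: "\<forall>\<^sub>F n in sequentially. sol_intrinsic_dist M (\<sigma> n) l
      \<le> ennreal (B * (\<bar>x - \<sigma> n $ 1\<bar> + \<bar>z - \<sigma> n $ 3\<bar>))"
    using order_tendstoD(1)[OF z a(2)] order_tendstoD(2)[OF z, of "z + 1", simplified]
  proof eventually_elim
    case (elim n)
    have "sol_intrinsic_dist M (\<sigma> n) l \<le> ennreal (B * (\<bar>l$1 - \<sigma> n $ 1\<bar> + \<bar>l$3 - \<sigma> n $ 3\<bar>))"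
      by (rule dist_upper_bound[OF M l _ _ a(1) B']) (use elim a in \<open>auto simp: l_def\<close>)
    then show ?case by (simp add: l_def)
  qed
  have "(\<lambda>n. B * (\<bar>x - \<sigma> n $ 1\<bar> + \<bar>z - \<sigma> n $ 3\<bar>)) \<longlonglongrightarrow> B * (\<bar>x - x\<bar> + \<bar>z - z\<bar>)"
    by (intro tendsto_intros x z)
  from tendsto_ennrealI[OF this]
  have "(\<lambda>n. ennreal (B * (\<bar>x - \<sigma> n $ 1\<bar> + \<bar>z - \<sigma> n $ 3\<bar>))) \<longlonglongrightarrow> 0"
    by simp
  with le have "(\<lambda>n. sol_intrinsic_dist M (\<sigma> n) l) \<longlonglongrightarrow> 0"
    by (rule tendsto_sandwich[OF always_eventually[OF allI[OF zero_le]] _ tendsto_const])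
  then show "\<exists>l\<in>M. (\<lambda>n. sol_intrinsic_dist M (\<sigma> n) l) \<longlonglongrightarrow> 0" using l by blast
qed

end


section \<open>The translator\<close>

theorem mainTheorem4:
  shows "\<exists>(V :: real^3 \<Rightarrow> real^3) (z1 :: real) (F :: real \<Rightarrow> real) (M :: (real^3) set).
    sol_killing V \<and> sol_translator V M \<and> sol_complete M \<and> F1_invariant M \<and>
    M = {vector [x, F z, z] | x z. z > z1}"
proof -
  \<comment> \<open>The height at which \<open>exp (- z)\<close> equals \<open>pi / 2\<close>, the
    first pole of the tangent met as \<open>z\<close> decreases.\<close>
  define z1 where "z1 = - ln (pi / 2)"
  \<comment> \<open>The derivative of the profile, obtained by solving
    \<open>slope z = - tan (exp (- z))\<close> for \<open>deriv F z\<close>; \<open>F\<close> itself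
    is an antiderivative.\<close>
  define f where "f z = - exp z * tan (exp (- z))" for z :: real
  have dom: "0 < exp (- z)" "exp (- z) < pi / 2" if "z > z1" for z
  proof -
    have "exp (- z) < exp (ln (pi / 2))" using that by (simp only: exp_less_cancel_iff z1_def)
    then show "exp (- z) < pi / 2" by simp
  qed simp
  have cos: "cos (exp (- z)) > 0" if "z > z1" for z
    using dom[OF that] by (intro cos_gt_zero)
  \<comment> \<open>Removing the zeros of the denominator gives an open set containing the real
    half-line, on which the complex version of \<open>f\<close> is holomorphic.\<close>
  define \<Omega> where "\<Omega> = {\<zeta> :: complex. cos (exp (- \<zeta>)) \<noteq> 0}"
  have "smooth_on {z1<..} (\<lambda>x. Re ((\<lambda>\<zeta>. - exp \<zeta> * (sin (exp (- \<zeta>)) / cos (exp (- \<zeta>)))) (of_real x)))"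
  proof (rule smooth_on_Re_holomorphic)
    show "(\<lambda>\<zeta>. - exp \<zeta> * (sin (exp (- \<zeta>)) / cos (exp (- \<zeta>)))) holomorphic_on \<Omega>"
      by (intro holomorphic_intros) (auto simp: \<Omega>_def)
    show "open \<Omega>" unfolding \<Omega>_def by (intro open_Collect_neq continuous_intros)
    show "complex_of_real ` {z1<..} \<subseteq> \<Omega>"
      using cos by (force simp: \<Omega>_def exp_of_real cos_of_real simp flip: of_real_minus)
  qed auto
  moreover have "Re (- exp (of_real x) * (sin (exp (- of_real x)) / cos (exp (- of_real x)))) = f x" for x :: real
    by (simp add: f_def tan_def exp_of_real sin_of_real cos_of_real
        flip: of_real_minus of_real_divide of_real_mult)
  ultimately have f: "smooth_on {z1<..} f" by simp
  then have "continuous_on {z1<..} f" by (metis Ck_on.simps(1) smooth_on_def)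
  then have "isCont f z" if "z > z1" for z using that by (simp add: continuous_on_eq_continuous_at)
  then obtain F where F: "\<And>z. z > z1 \<Longrightarrow> (F has_real_derivative f z) (at z)"
    using einterval_antiderivative[of "ereal z1" \<infinity> f]
    by (auto simp: has_real_derivative_iff_has_vector_derivative)
  interpret F1_graph z1 F
    by unfold_locales (rule smooth_on_antiderivative[OF f open_greaterThan F], simp)
  have F': "deriv F z = f z" if "z > z1" for z using F[OF that] by (rule DERIV_imp_deriv)
  have slope: "slope z = - tan (exp (- z))" if "z > z1" for z
    by (simp add: slope_def F'[OF that] f_def flip: exp_add mult.assoc)
  have "sol_translator sol_F2 M"
  proof (rule translator_F2)
    fix z assume z: "z > z1"
    \<comment> \<open>In the product rule, differentiating \<open>exp z\<close> reproduces
      \<open>f\<close>, while the inner derivative \<open>- exp (- z)\<close> cancels the factor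
      \<open>- exp z\<close> and leaves \<open>1 + tan ^ 2\<close>.\<close>
    have "(f has_real_derivative f z + (1 + (tan (exp (- z)))\<^sup>2)) (at z)"
      unfolding f_def using cos[OF z]
      by (auto intro!: derivative_eq_intros simp: tan_sec power_inverse exp_minus)
    then have "(deriv F has_real_derivative f z + (1 + (tan (exp (- z)))\<^sup>2)) (at z)"
      by (rule has_field_derivative_transform_within_open[of _ _ _ "{z1<..}"]) (use z F' in auto)
    from DERIV_imp_deriv[OF this] show "deriv (deriv F) z - deriv F z = 1 + (slope z)\<^sup>2"
      using z by (simp add: F' slope)
  qed
  moreover have "sol_complete M"
  proof (rule complete)
    fix z assume z: "z > z1"
    \<comment> \<open>Dividing by \<open>pi / 2\<close>, which exceeds \<open>exp (- z)\<close>,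
      brings the derivative below the absolute value of the slope.\<close>
    show "((\<lambda>z. ln (cos (exp (- z))) / (pi / 2)) has_real_derivative exp (- z) * tan (exp (- z)) / (pi / 2)) (at z)"
      using cos[OF z] by (auto intro!: derivative_eq_intros simp: tan_def)
    have "\<bar>exp (- z) * tan (exp (- z)) / (pi / 2)\<bar> = exp (- z) / (pi / 2) * \<bar>tan (exp (- z))\<bar>"
      by (simp add: abs_mult)
    also have "\<dots> \<le> 1 * \<bar>tan (exp (- z))\<bar>"
      using dom[OF z] by (intro mult_right_mono) auto
    also have "\<dots> \<le> sqrt (1 + (slope z)\<^sup>2)"
      by (rule real_le_rsqrt) (simp add: slope[OF z])
    finally show "\<bar>exp (- z) * tan (exp (- z)) / (pi / 2)\<bar> \<le> sqrt (1 + (slope z)\<^sup>2)" .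
  next
    have "((\<lambda>z. cos (exp (- z))) \<longlongrightarrow> cos (exp (- z1))) (at_right z1)"
      by (intro tendsto_intros)
    moreover have "cos (exp (- z1)) = 0" by (simp add: z1_def)
    \<comment> \<open>Positivity of the cosine makes it tend to 0 from above, where the logarithm
      tends to minus infinity.\<close>
    ultimately have "filterlim (\<lambda>z. cos (exp (- z))) (at_right 0) (at_right z1)"
      using cos by (force simp: filterlim_at eventually_at_filter intro!: always_eventually)
    then have "filterlim (\<lambda>z. ln (cos (exp (- z)))) at_bot (at_right z1)"
      by (rule filterlim_compose[OF ln_at_0])
    then have "filterlim (\<lambda>z. 2 / pi * ln (cos (exp (- z)))) at_bot (at_right z1)"
      by (intro filterlim_tendsto_pos_mult_at_bot[OF tendsto_const]) auto
    then show "filterlim (\<lambda>z. ln (cos (exp (- z))) / (pi / 2)) at_bot (at_right z1)"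
      by (simp add: mult.commute)
  qed
  moreover have "sol_killing sol_F2"
    unfolding sol_killing_def by (intro exI[of _ 0] exI[of _ 1]) (auto intro!: exI[of _ 0])
  ultimately show ?thesis using F1_invariant_M M_def by blast
qed

end
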